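(* Let $\mathbb{F}$ be a field, $S$ a semigroup and $\varrho$ a left equalizer simple congruence on $S$. Then $$\mathbb{F}[\varrho^*]=(\mathbb{F}[\varrho]:_r\mathbb{F}[S]).$$
   Context: $\mathbb{F}[S]$ denotes the semigroup algebra of $S$ over $\mathbb{F}$, having $S$ as an $\mathbb{F}$-basis with multiplication extending that of $S$; its elements are the finite sums $\sum_{s\in S}a(s)s$ with $a(s)\in\mathbb{F}$ (only finitely many nonzero). For a congruence $\varrho$ on $S$, $\mathbb{F}[\varrho]$ denotes the ideal of $\mathbb{F}[S]$ that is the kernel of the extension $\mathbb{F}[S]\to\mathbb{F}[S/\varrho]$ of the canonical homomorphism $S\to S/\varrho$; equivalently, $\sum_{s\in S}a(s)s\in\mathbb{F}[\varrho]$ if and only if $\sum_{s\in A}a(s)=0$ for every $\varrho$-class $A$ of $S$. For an ideal $J$ of $\mathbb{F}[S]$, $(J:_r\mathbb{F}[S])=\{a\in\mathbb{F}[S]: \mathbb{F}[S]a\subseteq J\}$ is the right colon of $J$. For a congruence $\varrho$ on $S$, $\varrho^*$ denotes the congruence on $S$ defined by: $(a,b)\in\varrho^*$ if and only if $(xa,xb)\in\varrho$ for all $x\in S$. A congruence $\varrho$ on $S$ is left equalizer simple if for all $a,b\in S$, $(x_0a,x_0b)\in\varrho$ for some $x_0\in S$ implies $(xa,xb)\in\varrho$ for all $x\in S$. *)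

theory Defs
  imports Complex_Main "HOL-Library.Poly_Mapping"
begin

text \<open>
  The semigroup algebra of a semigroup \<open>'s\<close> over a field \<open>'k\<close> is carried by the type
  \<open>'s \<Rightarrow>\<^sub>0 'k\<close> of finitely supported functions; the basis element \<open>s\<close> is \<open>single s 1\<close>.
  The library product on this type needs an additive monoid of exponents, so the product
  is defined here, as the bilinear extension of the multiplication of the semigroup.
\<close>

definition sa_mult ::
    "('s::semigroup_mult \<Rightarrow>\<^sub>0 'k::field) \<Rightarrow> ('s \<Rightarrow>\<^sub>0 'k) \<Rightarrow> ('s \<Rightarrow>\<^sub>0 'k)"  (infixl \<open>\<star>\<close> 70)
  where "a \<star> b = (\<Sum>s\<in>Poly_Mapping.keys a. \<Sum>t\<in>Poly_Mapping.keys b.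
           Poly_Mapping.single (s * t) (Poly_Mapping.lookup a s * Poly_Mapping.lookup b t))"

definition sa_extend :: "('s \<Rightarrow> 't) \<Rightarrow> ('s \<Rightarrow>\<^sub>0 'k::field) \<Rightarrow> ('t \<Rightarrow>\<^sub>0 'k)"
  where "sa_extend f a =
    (\<Sum>s\<in>Poly_Mapping.keys a. Poly_Mapping.single (f s) (Poly_Mapping.lookup a s))"

definition congruence :: "'s::semigroup_mult rel \<Rightarrow> bool"
  where "congruence \<rho> \<longleftrightarrow> equiv UNIV \<rho> \<and>
    (\<forall>a b c. (a, b) \<in> \<rho> \<longrightarrow> (c * a, c * b) \<in> \<rho> \<and> (a * c, b * c) \<in> \<rho>)"

text \<open>
  The map \<open>\<lambda>s. \<rho> `` {s}\<close> is the canonical homomorphism onto the quotient, whose elements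
  are the \<open>\<rho>\<close>-classes; \<open>congruence_ideal \<rho>\<close> is the kernel of its linear extension.
\<close>

definition congruence_ideal :: "'s::semigroup_mult rel \<Rightarrow> ('s \<Rightarrow>\<^sub>0 'k::field) set"
  where "congruence_ideal \<rho> = {a. sa_extend (\<lambda>s. \<rho> `` {s}) a = 0}"

definition right_colon :: "('s::semigroup_mult \<Rightarrow>\<^sub>0 'k::field) set \<Rightarrow> ('s \<Rightarrow>\<^sub>0 'k) set"
  where "right_colon J = {a. \<forall>x. x \<star> a \<in> J}"

definition star_congruence :: "'s::semigroup_mult rel \<Rightarrow> 's rel"
  where "star_congruence \<rho> = {(a, b). \<forall>x. (x * a, x * b) \<in> \<rho>}"

definition left_equalizer_simple :: "'s::semigroup_mult rel \<Rightarrow> bool"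
  where "left_equalizer_simple \<rho> \<longleftrightarrow>
    (\<forall>a b. (\<exists>x\<^sub>0. (x\<^sub>0 * a, x\<^sub>0 * b) \<in> \<rho>) \<longrightarrow> (\<forall>x. (x * a, x * b) \<in> \<rho>))"

lemma congruence_star_congruence:
  assumes "congruence \<rho>"
  shows "congruence (star_congruence \<rho>)"
proof -
  have eq: "equiv UNIV \<rho>"
    and r: "\<And>a b c. (a, b) \<in> \<rho> \<Longrightarrow> (a * c, b * c) \<in> \<rho>"
    using assms by (auto simp: congruence_def)
  have "equiv UNIV (star_congruence \<rho>)"
  proof (rule equivI)
    show "refl (star_congruence \<rho>)"
      using eq by (auto simp: star_congruence_def equiv_def refl_on_def)
    show "sym (star_congruence \<rho>)"
      using eq by (auto simp: star_congruence_def equiv_def sym_def)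
    show "trans (star_congruence \<rho>)"
      using eq by (fastforce simp: star_congruence_def equiv_def intro: transI dest: transD)
  qed simp
  then show ?thesis
    using r by (auto simp: congruence_def star_congruence_def mult.assoc[symmetric])
qed

lemma sa_mult_single:
  "Poly_Mapping.single s u \<star> Poly_Mapping.single t v = Poly_Mapping.single (s * t) (u * v)"
  by (cases "u = 0"; cases "v = 0") (auto simp: sa_mult_def)

lemma sa_mult_superset:
  assumes "finite A" "finite B" "Poly_Mapping.keys a \<subseteq> A" "Poly_Mapping.keys b \<subseteq> B"
  shows "a \<star> b = (\<Sum>s\<in>A. \<Sum>t\<in>B.
           Poly_Mapping.single (s * t) (Poly_Mapping.lookup a s * Poly_Mapping.lookup b t))"
proof -
  have "a \<star> b = (\<Sum>s\<in>Poly_Mapping.keys a. \<Sum>t\<in>B.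
           Poly_Mapping.single (s * t) (Poly_Mapping.lookup a s * Poly_Mapping.lookup b t))"
    unfolding sa_mult_def
    by (intro sum.cong[OF refl] sum.mono_neutral_left) (use assms in \<open>auto simp: in_keys_iff\<close>)
  also have "\<dots> = (\<Sum>s\<in>A. \<Sum>t\<in>B.
           Poly_Mapping.single (s * t) (Poly_Mapping.lookup a s * Poly_Mapping.lookup b t))"
    by (intro sum.mono_neutral_left) (use assms in \<open>auto simp: in_keys_iff\<close>)
  finally show ?thesis .
qed

lemma sa_mult_add_left: "(a + b) \<star> c = a \<star> c + b \<star> c"
proof -
  let ?A = "Poly_Mapping.keys a \<union> Poly_Mapping.keys b" and ?B = "Poly_Mapping.keys c"
  have k: "Poly_Mapping.keys (a + b) \<subseteq> ?A" by (rule Poly_Mapping.keys_add)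
  show ?thesis
    using sa_mult_superset[of ?A ?B "a + b" "c"] sa_mult_superset[of ?A ?B a c]
      sa_mult_superset[of ?A ?B b c] k
    by (simp add: lookup_add distrib_right single_add sum.distrib)
qed

lemma sa_mult_add_right: "a \<star> (b + c) = a \<star> b + a \<star> c"
proof -
  let ?A = "Poly_Mapping.keys a" and ?B = "Poly_Mapping.keys b \<union> Poly_Mapping.keys c"
  have k: "Poly_Mapping.keys (b + c) \<subseteq> ?B" by (rule Poly_Mapping.keys_add)
  show ?thesis
    using sa_mult_superset[of ?A ?B "a" "b + c"] sa_mult_superset[of ?A ?B a b]
      sa_mult_superset[of ?A ?B a c] k
    by (simp add: lookup_add distrib_left single_add sum.distrib)
qed

lemma congruence_ideal_iff_class_sums:
  assumes "congruence \<rho>"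
  shows "a \<in> congruence_ideal \<rho> \<longleftrightarrow>
    (\<forall>A\<in>UNIV // \<rho>. (\<Sum>s\<in>Poly_Mapping.keys a \<inter> A. Poly_Mapping.lookup a s) = 0)"
proof -
  have eq: "equiv UNIV \<rho>" using assms by (simp add: congruence_def)
  have lk: "Poly_Mapping.lookup (sa_extend (\<lambda>s. \<rho> `` {s}) a) A =
      (\<Sum>s\<in>{s \<in> Poly_Mapping.keys a. \<rho> `` {s} = A}. Poly_Mapping.lookup a s)" for A
    by (simp add: sa_extend_def lookup_sum lookup_single when_def sum.inter_filter)
  have cl: "{s \<in> Poly_Mapping.keys a. \<rho> `` {s} = A} = Poly_Mapping.keys a \<inter> A"
    if "A \<in> UNIV // \<rho>" for A
  proof -
    from that obtain t where "A = \<rho> `` {t}" by (auto elim: quotientE)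
    then have "\<rho> `` {s} = A \<longleftrightarrow> s \<in> A" for s
      using eq_equiv_class_iff[OF eq, of t s] by auto
    then show ?thesis by blast
  qed
  have em: "{s \<in> Poly_Mapping.keys a. \<rho> `` {s} = A} = {}" if "A \<notin> UNIV // \<rho>" for A
    using that by (auto simp: quotient_def)
  have "a \<in> congruence_ideal \<rho> \<longleftrightarrow>
      (\<forall>A. Poly_Mapping.lookup (sa_extend (\<lambda>s. \<rho> `` {s}) a) A = 0)"
    by (simp add: congruence_ideal_def poly_mapping_eq_iff fun_eq_iff)
  also have "\<dots> \<longleftrightarrow> (\<forall>A\<in>UNIV // \<rho>. (\<Sum>s\<in>Poly_Mapping.keys a \<inter> A. Poly_Mapping.lookup a s) = 0)"
  proof (intro iffI ballI allI)
    fix A assume "\<forall>A. Poly_Mapping.lookup (sa_extend (\<lambda>s. \<rho> `` {s}) a) A = 0" "A \<in> UNIV // \<rho>"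
    then show "(\<Sum>s\<in>Poly_Mapping.keys a \<inter> A. Poly_Mapping.lookup a s) = 0"
      using lk[of A] cl[of A] by simp
  next
    fix A assume "\<forall>A\<in>UNIV // \<rho>. (\<Sum>s\<in>Poly_Mapping.keys a \<inter> A. Poly_Mapping.lookup a s) = 0"
    then show "Poly_Mapping.lookup (sa_extend (\<lambda>s. \<rho> `` {s}) a) A = 0"
      by (cases "A \<in> UNIV // \<rho>") (simp_all add: lk cl em)
  qed
  finally show ?thesis .
qed

end

(* Writing f for the canonical homomorphism of rho, the coefficients of the image of x * a are
   combinations, weighted by the coefficients of x, of the coefficients of the images of a under
   the maps t |-> f (s t). As rho is left equalizer simple, each of these maps has kernel relation
   rho^*, so each of them kills the same elements a as the canonical homomorphism of rho^*. *)
theory Submission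
  imports Defs
begin

text \<open>Cancellation can shrink the support of \<open>a + b\<close>, so additivity is checked
  termwise over an index set common to \<open>a\<close>, \<open>b\<close> and
  \<open>a + b\<close>.\<close>

lemma sa_extend_superset:
  assumes "finite A" "Poly_Mapping.keys a \<subseteq> A"
  shows "sa_extend f a =
    (\<Sum>s\<in>A. Poly_Mapping.single (f s) (Poly_Mapping.lookup a s))"
  unfolding sa_extend_def
  by (intro sum.mono_neutral_left) (use assms in \<open>auto simp: in_keys_iff\<close>)

lemma sa_extend_add: "sa_extend f (a + b) = sa_extend f a + sa_extend f b"
proof -
  let ?A = "Poly_Mapping.keys a \<union> Poly_Mapping.keys b"
  have "Poly_Mapping.keys (a + b) \<subseteq> ?A"
    by (rule Poly_Mapping.keys_add)
  then show ?thesis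
    using sa_extend_superset[of ?A "a + b" f] sa_extend_superset[of ?A a f]
      sa_extend_superset[of ?A b f]
    by (simp add: lookup_add single_add sum.distrib)
qed

lemma sa_extend_sum: "sa_extend f (\<Sum>i\<in>I. g i) = (\<Sum>i\<in>I. sa_extend f (g i))"
proof (induction I rule: infinite_finite_induct)
  case (insert i I)
  then show ?case by (simp add: sa_extend_add)
qed (simp_all add: sa_extend_def)

lemma sa_extend_single:
  "sa_extend f (Poly_Mapping.single s c) = Poly_Mapping.single (f s) c"
  by (cases "c = 0") (simp_all add: sa_extend_def)

lemma lookup_sa_extend:
  "Poly_Mapping.lookup (sa_extend f a) u =
    (\<Sum>s\<in>{s \<in> Poly_Mapping.keys a. f s = u}. Poly_Mapping.lookup a s)"
  by (simp add: sa_extend_def lookup_sum lookup_single when_def sum.inter_filter)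

text \<open>Group the terms of \<open>x \<star> a\<close> by their left factor \<open>s\<close>. For
  fixed \<open>s\<close>, the basis element \<open>t\<close> contributes at
  \<open>f (s * t)\<close>, and the coefficient of \<open>s\<close> in \<open>x\<close> factors
  out.\<close>

lemma lookup_sa_extend_mult:
  "Poly_Mapping.lookup (sa_extend f (x \<star> a)) u =
    (\<Sum>s\<in>Poly_Mapping.keys x.
      Poly_Mapping.lookup x s * Poly_Mapping.lookup (sa_extend (\<lambda>t. f (s * t)) a) u)"
  unfolding sa_mult_def sa_extend_sum sa_extend_single lookup_sum
  by (simp add: lookup_sa_extend lookup_single when_def sum.inter_filter sum_distrib_left
      if_distrib cong: if_cong)

lemma sa_extend_single_mult:
  "sa_extend f (Poly_Mapping.single s 1 \<star> a) = sa_extend (\<lambda>t. f (s * t)) a"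
  by (rule poly_mapping_eqI) (simp add: lookup_sa_extend_mult)

text \<open>Coefficients outside the range of \<open>f\<close> are empty sums, so only the fibres of
  \<open>f\<close> matter. Naming each fibre by a point \<open>t\<close> of the domain leaves a
  condition on the kernel relation of \<open>f\<close> alone.\<close>

lemma sa_extend_eq_0_iff:
  "sa_extend f a = 0 \<longleftrightarrow>
    (\<forall>t. (\<Sum>s\<in>{s \<in> Poly_Mapping.keys a. f s = f t}. Poly_Mapping.lookup a s) = 0)"
proof
  assume "sa_extend f a = 0"
  then show "\<forall>t. (\<Sum>s\<in>{s \<in> Poly_Mapping.keys a. f s = f t}. Poly_Mapping.lookup a s) = 0"
    by (metis lookup_sa_extend lookup_zero)
next
  assume *: "\<forall>t. (\<Sum>s\<in>{s \<in> Poly_Mapping.keys a. f s = f t}. Poly_Mapping.lookup a s) = 0"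
  show "sa_extend f a = 0"
  proof (rule poly_mapping_eqI)
    fix u
    show "Poly_Mapping.lookup (sa_extend f a) u = Poly_Mapping.lookup 0 u"
    proof (cases "u \<in> range f")
      case True
      then show ?thesis using * by (auto simp: lookup_sa_extend)
    next
      case False
      then have "{s \<in> Poly_Mapping.keys a. f s = u} = {}" by auto
      then show ?thesis by (simp only: lookup_sa_extend lookup_zero sum.empty)
    qed
  qed
qed

lemma sa_extend_eq_0_cong:
  assumes "\<And>s t. f s = f t \<longleftrightarrow> g s = g t"
  shows "sa_extend f a = 0 \<longleftrightarrow> sa_extend g a = 0"
  by (simp add: sa_extend_eq_0_iff assms)

lemma right_colon_congruence_ideal:
  fixes \<rho> :: "'s::semigroup_mult rel"
  shows "right_colon (congruence_ideal \<rho>) =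
    {a :: 's \<Rightarrow>\<^sub>0 'k::field. \<forall>s. sa_extend (\<lambda>t. \<rho> `` {s * t}) a = 0}"
proof (intro set_eqI iffI)
  fix a :: "'s \<Rightarrow>\<^sub>0 'k"
  assume "a \<in> right_colon (congruence_ideal \<rho>)"
  \<comment> \<open>The defining condition of the colon is tested on the basis element
    \<open>s\<close> only.\<close>
  then have "sa_extend (\<lambda>t. \<rho> `` {t}) (Poly_Mapping.single s 1 \<star> a) = 0" for s
    by (simp add: right_colon_def congruence_ideal_def)
  then show "a \<in> {a. \<forall>s. sa_extend (\<lambda>t. \<rho> `` {s * t}) a = 0}"
    by (simp add: sa_extend_single_mult)
next
  fix a :: "'s \<Rightarrow>\<^sub>0 'k"
  assume "a \<in> {a. \<forall>s. sa_extend (\<lambda>t. \<rho> `` {s * t}) a = 0}"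
  then show "a \<in> right_colon (congruence_ideal \<rho>)"
    \<comment> \<open>For arbitrary \<open>x\<close>, every coefficient of the image of
      \<open>x \<star> a\<close> is a weighted sum of coefficients that vanish by
      assumption.\<close>
    by (auto simp: right_colon_def congruence_ideal_def lookup_sa_extend_mult
        intro!: poly_mapping_eqI)
qed

text \<open>Left equalizer simplicity carries a relation between \<open>x * s\<close> and
  \<open>x * t\<close> from a single \<open>x\<close> to all multipliers; conversely,
  \<open>x\<close> is an instance of the quantifier in \<open>star_congruence\<close>.\<close>

lemma star_class_eq_iff:
  assumes "congruence \<rho>" "left_equalizer_simple \<rho>"
  shows "\<rho> `` {x * s} = \<rho> `` {x * t} \<longleftrightarrow> star_congruence \<rho> `` {s} = star_congruence \<rho> `` {t}"
proof -
  have "equiv UNIV \<rho>" "equiv UNIV (star_congruence \<rho>)"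
    using assms(1) congruence_star_congruence by (auto simp: congruence_def)
  moreover have "(x * s, x * t) \<in> \<rho> \<longleftrightarrow> (s, t) \<in> star_congruence \<rho>"
    using assms(2) by (auto simp: left_equalizer_simple_def star_congruence_def)
  ultimately show ?thesis
    by (simp add: eq_equiv_class_iff)
qed

theorem theorem3p2:
  fixes \<rho> :: "'s::semigroup_mult rel"
  assumes "congruence \<rho>"
    and "left_equalizer_simple \<rho>"
  shows "(congruence_ideal (star_congruence \<rho>) :: ('s \<Rightarrow>\<^sub>0 'k::field) set)
       = right_colon (congruence_ideal \<rho>)"
proof -
  have "sa_extend (\<lambda>t. \<rho> `` {x * t}) a = 0 \<longleftrightarrow>
      sa_extend (\<lambda>t. star_congruence \<rho> `` {t}) a = 0" for x and a :: "'s \<Rightarrow>\<^sub>0 'k"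
    by (rule sa_extend_eq_0_cong) (rule star_class_eq_iff[OF assms])
  \<comment> \<open>The condition on \<open>a\<close> no longer depends on the multiplier, so the
    quantifier over it drops; the semigroup is nonempty, being a type.\<close>
  then show ?thesis
    unfolding right_colon_congruence_ideal by (simp add: congruence_ideal_def)
qed

end
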